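(* Let $G=(V,E)$ be a connected amply regular graph with parameters $(n,d,\alpha,\beta)$, where $n\geq 2$. Let $\sigma_1\leq\sigma_2\leq\cdots\leq\sigma_{n-1}\leq\sigma_n=d$ be the eigenvalues (with multiplicity) of its adjacency matrix. (i) If $\beta\neq 1$ and $\beta\geq\alpha$, then $\sigma_{n-1}\leq d-2$. (ii) If $\beta>\alpha\geq 1$, then $\sigma_{n-1}\leq d-3$.
   Context: Graphs are finite and simple. An amply regular graph with parameters $(n,d,\alpha,\beta)$ is a $d$-regular graph on $n$ vertices such that (i) any two adjacent vertices have exactly $\alpha$ common neighbors, and (ii) any two vertices at distance $2$ have exactly $\beta$ common neighbors. *)

theory Defs
  imports
    "Jordan_Normal_Form.Char_Poly"
    "Graph_Theory.Graph_Theory"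
begin

text \<open>
  The locale \<^locale>\<open>graph\<close> describes finite simple graphs as symmetric digraphs, so every edge
  is a pair of opposite arcs and the degree of a vertex is its out-degree. The graph distance is
  \<^const>\<open>wf_digraph.\<mu>\<close> for the arc weights constantly 1. If there are no pairs at distance 2, as
  in a complete graph, the parameter \<open>\<beta>\<close> is arbitrary.
\<close>

definition common_neighbors :: "('a, 'b) pre_digraph \<Rightarrow> 'a \<Rightarrow> 'a \<Rightarrow> 'a set" where
  "common_neighbors G u v = {w \<in> verts G. u \<rightarrow>\<^bsub>G\<^esub> w \<and> v \<rightarrow>\<^bsub>G\<^esub> w}"

locale amply_regular_graph = graph G
  for G :: "('a, 'b) pre_digraph" (structure) +
  fixes n d \<alpha> \<beta> :: nat
  assumes card_verts: "card (verts G) = n"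
    and regular: "v \<in> verts G \<Longrightarrow> out_degree G v = d"
    and adjacent: "\<lbrakk>u \<in> verts G; v \<in> verts G; u \<rightarrow> v\<rbrakk> \<Longrightarrow> card (common_neighbors G u v) = \<alpha>"
    and distance_two: "\<lbrakk>u \<in> verts G; v \<in> verts G; \<mu> (\<lambda>_. 1) u v = 2\<rbrakk>
      \<Longrightarrow> card (common_neighbors G u v) = \<beta>"

text \<open>The list \<open>vs\<close> is an enumeration of the vertices; it indexes the rows and columns.\<close>

definition adjacency_matrix :: "('a, 'b) pre_digraph \<Rightarrow> 'a list \<Rightarrow> real mat" where
  "adjacency_matrix G vs =
    mat (length vs) (length vs) (\<lambda>(i, j). if vs ! i \<rightarrow>\<^bsub>G\<^esub> vs ! j then 1 else 0)"

text \<open>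
  \<open>\<sigma> 1 \<le> \<dots> \<le> \<sigma> n\<close> are the eigenvalues of the \<open>n \<times> n\<close> matrix \<open>A\<close>, repeated according to their
  multiplicity as roots of the characteristic polynomial. The values of \<open>\<sigma>\<close> outside \<open>{1..n}\<close> are
  irrelevant. For a real symmetric \<open>A\<close> such a \<open>\<sigma>\<close> exists and is unique on \<open>{1..n}\<close>.
\<close>

definition ordered_eigenvalues :: "real mat \<Rightarrow> (nat \<Rightarrow> real) \<Rightarrow> bool" where
  "ordered_eigenvalues A \<sigma> \<longleftrightarrow>
    mono_on {1..dim_row A} \<sigma> \<and> char_poly A = (\<Prod>i = 1..dim_row A. [:- \<sigma> i, 1:])"

end

theory Submission
  imports Defs "Jordan_Normal_Form.Schur_Decomposition"
begin

text \<open>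
  Let \<open>f\<close> be a nonconstant eigenfunction for the eigenvalue \<open>c\<close>, and let \<open>xy\<close> be an arc at which
  \<open>f x - f y\<close> attains its maximum \<open>L > 0\<close>. Put \<open>P = N(x) - {y}\<close> and \<open>Q = N(y) - {x}\<close>, so that
  \<open>P \<inter> Q\<close> has \<open>\<alpha>\<close> elements. A vertex of \<open>P\<close> has \<open>\<alpha> - 1\<close> neighbors in \<open>Q\<close> if it lies in \<open>Q\<close> and
  \<open>\<beta> - 1\<close> otherwise, and vice versa. Hence \<open>(\<beta> - 1) (\<Sum>\<^sub>P f - \<Sum>\<^sub>Q f)\<close> is the sum of \<open>f u - f v\<close>
  over the arcs \<open>uv\<close> from \<open>P\<close> to \<open>Q\<close>, each term being at most \<open>L\<close>. Since the left-hand side is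
  \<open>(\<beta> - 1) (c + 1) L\<close>, counting these arcs gives \<open>(\<beta> - 1) (c - d + 2) \<le> - \<alpha> (\<beta> - \<alpha>)\<close>. The
  largest eigenvalue \<open>d\<close> is simple, so this applies to \<open>\<sigma> (n - 1)\<close>.
\<close>

section \<open>Jordan chains at a multiple root of the characteristic polynomial\<close>

text \<open>Schur triangularization can put the two copies of \<open>k\<close> first on the
  diagonal; the first two columns of the transition matrix then span an invariant plane.
  Multiplicity is algebraic here, so an off-diagonal entry \<open>b\<close> has to be
  allowed.\<close>

lemma double_root_chain:
  fixes A :: "real mat"
  assumes A: "A \<in> carrier_mat n n"
    and char: "char_poly A = (\<Prod>a\<leftarrow>k # k # es. [:- a, 1:])"
  obtains v w b where "v \<in> carrier_vec n" "w \<in> carrier_vec n" "v \<noteq> 0\<^sub>v n" "\<And>t. w \<noteq> t \<cdot>\<^sub>v v"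
    "A *\<^sub>v v = k \<cdot>\<^sub>v v" "A *\<^sub>v w = k \<cdot>\<^sub>v w + b \<cdot>\<^sub>v v"
proof -
  obtain B P Q where dec: "schur_decomposition A (k # k # es) = (B, P, Q)"
    by (cases "schur_decomposition A (k # k # es)") auto
  have sim: "similar_mat_wit A B P Q" and ut: "upper_triangular B"
    and diag: "diag_mat B = k # k # es"
    using schur_decomposition[OF A char dec] by auto
  note s = similar_mat_witD2[OF A sim]
  note B = s(5) and P = s(6) and Q = s(7)
  have n: "n \<ge> 2"
    using arg_cong[OF diag, of length] B by (simp add: diag_mat_def)
  have B00: "B $$ (0, 0) = k" and B11: "B $$ (1, 1) = k"
    using arg_cong[OF diag, of "\<lambda>l. l ! 0"] arg_cong[OF diag, of "\<lambda>l. l ! 1"] B n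
    by (auto simp: diag_mat_def)
  have AP: "A * P = P * B"
  proof -
    have "A * P = P * B * (Q * P)"
      by (subst s(3)) (use B P Q in \<open>simp add: assoc_mult_mat[of _ n n _ n _ n]\<close>)
    then show ?thesis
      using B P by (simp add: s(2))
  qed
  define v w where "v = col P 0" and "w = col P 1"
  have vw: "v \<in> carrier_vec n" "w \<in> carrier_vec n"
    unfolding v_def w_def using n by (auto intro!: col_carrier_vec[OF _ P])
  have colB0: "col B 0 = k \<cdot>\<^sub>v unit_vec n 0"
  proof (intro eq_vecI)
    fix i assume "i < dim_vec (k \<cdot>\<^sub>v unit_vec n 0)"
    then have i: "i < n" by simp
    show "col B 0 $ i = (k \<cdot>\<^sub>v unit_vec n 0) $ i"
      using i B n B00 upper_triangularD[OF ut, of 0 i] by (cases "i = 0") auto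
  qed (use B in auto)
  have colB1: "col B 1 = k \<cdot>\<^sub>v unit_vec n 1 + B $$ (0, 1) \<cdot>\<^sub>v unit_vec n 0"
  proof (intro eq_vecI)
    fix i assume "i < dim_vec (k \<cdot>\<^sub>v unit_vec n 1 + B $$ (0, 1) \<cdot>\<^sub>v unit_vec n 0)"
    then have i: "i < n" by simp
    consider "i = 0" | "i = 1" | "i > 1" by linarith
    then show "col B 1 $ i = (k \<cdot>\<^sub>v unit_vec n 1 + B $$ (0, 1) \<cdot>\<^sub>v unit_vec n 0) $ i"
      using i B n B11 upper_triangularD[OF ut, of 1 i] by cases auto
  qed (use B in auto)
  have Pe: "P *\<^sub>v unit_vec n i = col P i" if "i < n" for i
    using P that by (intro eq_vecI) auto
  have Av: "A *\<^sub>v v = k \<cdot>\<^sub>v v"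
  proof -
    have "A *\<^sub>v v = col (A * P) 0"
      unfolding v_def using n by (intro col_mult2[OF A P, symmetric]) simp
    also have "\<dots> = P *\<^sub>v col B 0"
      unfolding AP using n by (intro col_mult2[OF P B]) simp
    also have "\<dots> = k \<cdot>\<^sub>v v"
      using P n Pe[of 0] by (simp add: colB0 v_def mult_mat_vec[OF P])
    finally show ?thesis .
  qed
  have Aw: "A *\<^sub>v w = k \<cdot>\<^sub>v w + B $$ (0, 1) \<cdot>\<^sub>v v"
  proof -
    have "A *\<^sub>v w = col (A * P) 1"
      unfolding w_def using n by (intro col_mult2[OF A P, symmetric]) simp
    also have "\<dots> = P *\<^sub>v col B 1"
      unfolding AP using n by (intro col_mult2[OF P B]) simp
    also have "\<dots> = k \<cdot>\<^sub>v w + B $$ (0, 1) \<cdot>\<^sub>v v"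
      unfolding colB1 using P n Pe[of 0] Pe[of 1]
      by (simp add: v_def w_def mult_add_distrib_mat_vec[OF P] mult_mat_vec[OF P])
    finally show ?thesis .
  qed
  \<comment> \<open>Since \<open>Q\<close> inverts \<open>P\<close>, it carries a linear relation
    between \<open>v\<close> and \<open>w\<close> to one between unit vectors, where it visibly
    fails.\<close>
  have Qcol: "Q *\<^sub>v col P i = unit_vec n i" if "i < n" for i
  proof -
    have "Q *\<^sub>v col P i = col (Q * P) i"
      using col_mult2[OF Q P that] by simp
    then show ?thesis
      using s(2) that by simp
  qed
  have "v \<noteq> 0\<^sub>v n"
  proof
    assume "v = 0\<^sub>v n"
    then have "v = 0 \<cdot>\<^sub>v v"
      by (intro eq_vecI) auto
    then have "unit_vec n 0 = (0 :: real) \<cdot>\<^sub>v unit_vec n 0"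
      using Qcol[of 0] n mult_mat_vec[OF Q vw(1), of 0] by (simp add: v_def)
    from arg_cong[OF this, of "\<lambda>x. x $ 0"] show False
      using n by simp
  qed
  moreover have "w \<noteq> t \<cdot>\<^sub>v v" for t
  proof
    assume "w = t \<cdot>\<^sub>v v"
    then have "unit_vec n 1 = t \<cdot>\<^sub>v unit_vec n 0"
      using Qcol[of 0] Qcol[of 1] n vw(1) Q by (simp add: v_def w_def mult_mat_vec)
    from arg_cong[OF this, of "\<lambda>x. x $ 1"] show False
      using n by simp
  qed
  ultimately show ?thesis
    using that vw Av Aw by blast
qed

section \<open>Distance two and connectivity in digraphs\<close>

lemma (in wf_digraph) adj_if_awalk_single:
  "awalk u [e] v \<Longrightarrow> u \<rightarrow> v"
  by (auto simp: awalk_simps intro: in_arcs_imp_in_arcs_ends)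

text \<open>The walk through \<open>w\<close> bounds the distance from above; a cheaper walk would
  be empty or a single arc. This makes the distance condition of the locale usable in terms of
  adjacency.\<close>

lemma (in wf_digraph) unit_distance_two:
  assumes "u \<rightarrow> w" "w \<rightarrow> v" "u \<noteq> v" "\<not> u \<rightarrow> v"
  shows "\<mu> (\<lambda>_. 1) u v = 2"
proof (rule antisym)
  obtain e1 where "e1 \<in> arcs G" "tail G e1 = u" "head G e1 = w"
    using assms(1) by (auto simp: arcs_ends_def arc_to_ends_def)
  moreover obtain e2 where "e2 \<in> arcs G" "tail G e2 = w" "head G e2 = v"
    using assms(2) by (auto simp: arcs_ends_def arc_to_ends_def)
  ultimately have "awalk u [e1, e2] v"
    by (auto simp: awalk_simps)
  from min_cost_le_walk_cost[OF this, of "\<lambda>_. 1"] show "\<mu> (\<lambda>_. 1) u v \<le> 2"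
    by simp
next
  have "2 \<le> awalk_cost (\<lambda>_. 1) p" if p: "awalk u p v" for p
  proof -
    have "p \<noteq> []" using p assms(3) by (auto simp: awalk_simps)
    moreover have "p \<noteq> [e]" for e using p assms(4) adj_if_awalk_single by blast
    ultimately obtain a b q where "p = a # b # q"
      by (metis list.exhaust)
    moreover have "0 \<le> awalk_cost (\<lambda>_. 1) q"
      by (simp add: awalk_cost_def sum_list_triv)
    ultimately show ?thesis by simp
  qed
  then show "2 \<le> \<mu> (\<lambda>_. 1) u v"
    unfolding \<mu>_def by (intro INF_greatest) simp
qed

lemma (in graph) constant_if_constant_on_arcs:
  assumes con: "connected G" and arcs: "\<And>x y. x \<rightarrow> y \<Longrightarrow> f x = f y"
    and "x \<in> verts G" "y \<in> verts G"
  shows "f x = f y"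
proof -
  have "strongly_connected G"
    using symmetric_connected_imp_strongly_connected[OF sym_arcs con] .
  then have "x \<rightarrow>\<^sup>* y"
    using assms(3,4) by blast
  then show ?thesis
    by (induction rule: reachable_induct) (use arcs in auto)
qed

section \<open>Eigenfunctions and the Dirichlet form\<close>

context amply_regular_graph
begin

abbreviation neighbors :: "'a \<Rightarrow> 'a set" where
  "neighbors v \<equiv> {w \<in> verts G. v \<rightarrow> w}"

lemma adj_sym: "u \<rightarrow> v \<longleftrightarrow> v \<rightarrow> u"
  using sym_arcs by (auto simp: symmetric_def sym_def)

lemma adj_irrefl [simp]: "\<not> v \<rightarrow> v"
  using adj_not_same by blast

lemma card_neighbors:
  assumes "v \<in> verts G"
  shows "card (neighbors v) = d"
proof -
  have "bij_betw (head G) (out_arcs G v) (neighbors v)"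
    unfolding bij_betw_def
  proof
    show "inj_on (head G) (out_arcs G v)"
      by (auto simp: inj_on_def arc_to_ends_def intro: no_multi_arcs)
    show "head G ` out_arcs G v = neighbors v"
      by (auto simp: arcs_ends_def arc_to_ends_def image_iff)
  qed
  then show ?thesis
    using regular[OF assms] by (simp add: out_degree_def bij_betw_same_card)
qed

text \<open>Double counting: by symmetry and regularity, each value \<open>g w\<close> is collected
  once from each of the \<open>d\<close> neighbors of \<open>w\<close>.\<close>

lemma sum_sum_neighbors:
  fixes g :: "'a \<Rightarrow> real"
  shows "(\<Sum>x\<in>verts G. \<Sum>w\<in>neighbors x. g w) = real d * (\<Sum>x\<in>verts G. g x)"
proof -
  have "(\<Sum>x\<in>verts G. \<Sum>w\<in>neighbors x. g w)
      = (\<Sum>w\<in>verts G. \<Sum>x\<in>{x \<in> verts G. x \<rightarrow> w}. g w)"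
    by (intro sum.swap_restrict) auto
  also have "\<dots> = (\<Sum>w\<in>verts G. real d * g w)"
    using card_neighbors by (intro sum.cong) (auto simp: adj_sym)
  finally show ?thesis by (simp add: sum_distrib_left)
qed

text \<open>After expanding the square, the eigenvalue equation evaluates the cross terms and double
  counting the terms \<open>(f w)\<^sup>2\<close>. The factor 2 appears because every edge is
  traversed in both directions.\<close>

lemma dirichlet_form:
  fixes f :: "'a \<Rightarrow> real"
  assumes eig: "\<And>x. x \<in> verts G \<Longrightarrow> (\<Sum>w\<in>neighbors x. f w) = c * f x"
  shows "(\<Sum>x\<in>verts G. \<Sum>w\<in>neighbors x. (f x - f w)\<^sup>2)
    = 2 * (real d - c) * (\<Sum>x\<in>verts G. (f x)\<^sup>2)"
proof -
  have "(\<Sum>w\<in>neighbors x. (f x - f w)\<^sup>2)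
      = (real d - 2 * c) * (f x)\<^sup>2 + (\<Sum>w\<in>neighbors x. (f w)\<^sup>2)" if x: "x \<in> verts G" for x
  proof -
    have "(\<Sum>w\<in>neighbors x. (f x - f w)\<^sup>2)
        = (\<Sum>w\<in>neighbors x. (f x)\<^sup>2 + (f w)\<^sup>2 - 2 * f x * f w)"
      by (simp add: power2_diff)
    also have "\<dots> = real d * (f x)\<^sup>2 + (\<Sum>w\<in>neighbors x. (f w)\<^sup>2)
        - 2 * f x * (\<Sum>w\<in>neighbors x. f w)"
      by (simp add: sum_subtractf sum.distrib sum_distrib_left card_neighbors[OF x])
    finally show ?thesis
      by (simp add: eig[OF x] algebra_simps power2_eq_square)
  qed
  then show ?thesis
    by (simp add: sum.distrib sum_sum_neighbors flip: sum_distrib_left) (simp add: algebra_simps)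
qed

text \<open>The Dirichlet form is nonnegative, while the sum of squares of a nonzero function is
  positive.\<close>

lemma eigenvalue_le_degree:
  fixes f :: "'a \<Rightarrow> real"
  assumes eig: "\<And>x. x \<in> verts G \<Longrightarrow> (\<Sum>w\<in>neighbors x. f w) = c * f x"
    and z: "z \<in> verts G" "f z \<noteq> 0"
  shows "c \<le> real d"
proof -
  have "0 < (\<Sum>x\<in>verts G. (f x)\<^sup>2)"
    using z by (intro sum_pos2[of _ z]) auto
  moreover have "0 \<le> (\<Sum>x\<in>verts G. \<Sum>w\<in>neighbors x. (f x - f w)\<^sup>2)"
    by (intro sum_nonneg) auto
  moreover have "\<dots> = 2 * (real d - c) * (\<Sum>x\<in>verts G. (f x)\<^sup>2)"
    by (rule dirichlet_form) (rule eig)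
  ultimately show ?thesis
    by (simp add: zero_le_mult_iff)
qed

text \<open>For the eigenvalue \<open>d\<close> the Dirichlet form vanishes, so \<open>f\<close>
  does not change along any arc, and connectivity does the rest.\<close>

lemma degree_eigenfunction_constant:
  fixes f :: "'a \<Rightarrow> real"
  assumes con: "connected G"
    and eig: "\<And>x. x \<in> verts G \<Longrightarrow> (\<Sum>w\<in>neighbors x. f w) = real d * f x"
    and "x \<in> verts G" "y \<in> verts G"
  shows "f x = f y"
proof (rule constant_if_constant_on_arcs[OF con _ assms(3,4)])
  fix u v assume uv: "u \<rightarrow> v"
  then have V: "u \<in> verts G" "v \<in> verts G"
    using adj_in_verts by auto
  have "(\<Sum>x\<in>verts G. \<Sum>w\<in>neighbors x. (f x - f w)\<^sup>2) = 0"
    using dirichlet_form[OF eig] by simp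
  then have "(\<Sum>w\<in>neighbors u. (f u - f w)\<^sup>2) = 0"
    using V by (subst (asm) sum_nonneg_eq_0_iff) (auto intro: sum_nonneg)
  then have "(f u - f v)\<^sup>2 = 0"
    using V uv by (subst (asm) sum_nonneg_eq_0_iff) auto
  then show "f u = f v" by simp
qed

section \<open>Arcs between the neighborhoods of two adjacent vertices\<close>

text \<open>The vertex \<open>w\<close> is itself a common neighbor, which rules out
  \<open>\<beta> = 0\<close> as soon as such a pair exists.\<close>

lemma card_common_neighbors_nonadjacent:
  assumes "u \<rightarrow> w" "w \<rightarrow> v" "u \<noteq> v" "\<not> u \<rightarrow> v"
  shows "card (common_neighbors G u v) = \<beta>" "\<beta> \<noteq> 0"
proof -
  have V: "u \<in> verts G" "v \<in> verts G" "w \<in> verts G"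
    using assms adj_in_verts by auto
  then show *: "card (common_neighbors G u v) = \<beta>"
    using unit_distance_two[OF assms] by (intro distance_two)
  have "w \<in> common_neighbors G u v" "finite (common_neighbors G u v)"
    using V assms by (auto simp: common_neighbors_def adj_sym)
  then show "\<beta> \<noteq> 0"
    unfolding *[symmetric] by (auto simp: card_gt_0_iff)
qed

text \<open>
  If \<open>\<beta> = 0\<close> then no two vertices are at distance 2, and \<open>\<beta>\<close> may be replaced by any number \<open>b\<close>.
\<close>

lemma sum_card_neighbors_across:
  fixes g :: "'a \<Rightarrow> real"
  assumes b: "\<beta> = 0 \<or> b = \<beta>" and xy: "x \<rightarrow> y"
  shows "(\<Sum>u\<in>neighbors x - {y}. real (card {v \<in> neighbors y - {x}. u \<rightarrow> v}) * g u)
    = (real b - 1) * (\<Sum>u\<in>neighbors x - {y}. g u)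
      - (real b - real \<alpha>) * (\<Sum>u\<in>common_neighbors G x y. g u)"
proof -
  let ?P = "neighbors x - {y}"
  have V: "x \<in> verts G" "y \<in> verts G"
    using xy adj_in_verts by auto
  \<comment> \<open>The neighbors of \<open>u\<close> in \<open>neighbors y - {x}\<close> are the
    common neighbors of \<open>u\<close> and \<open>y\<close> other than \<open>x\<close>. If
    \<open>u\<close> and \<open>y\<close> are not adjacent, the path through \<open>x\<close> puts
    them at distance 2.\<close>
  have card: "real (card {v \<in> neighbors y - {x}. u \<rightarrow> v})
      = real b - 1 - (if y \<rightarrow> u then real b - real \<alpha> else 0)" if u: "u \<in> ?P" for u
  proof -
    have x: "x \<in> common_neighbors G u y"
      using V xy u by (auto simp: common_neighbors_def adj_sym)
    have fin: "finite (common_neighbors G u y)"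
      by (simp add: common_neighbors_def)
    have "{v \<in> neighbors y - {x}. u \<rightarrow> v} = common_neighbors G u y - {x}"
      by (auto simp: common_neighbors_def)
    then have "real (card {v \<in> neighbors y - {x}. u \<rightarrow> v}) = real (card (common_neighbors G u y)) - 1"
      using card_Suc_Diff1[OF fin x] by simp
    moreover have "card (common_neighbors G u y) = \<alpha>" if "y \<rightarrow> u"
      using that u V adj_sym by (intro adjacent) auto
    moreover have "card (common_neighbors G u y) = b" if "\<not> y \<rightarrow> u"
      using card_common_neighbors_nonadjacent[of u x y] that u xy b adj_sym by auto
    ultimately show ?thesis by auto
  qed
  have "(\<Sum>u\<in>?P. real (card {v \<in> neighbors y - {x}. u \<rightarrow> v}) * g u)
      = (\<Sum>u\<in>?P. (real b - 1) * g u - (real b - real \<alpha>) * (if y \<rightarrow> u then g u else 0))"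
    by (intro sum.cong refl) (subst card, auto simp: algebra_simps)
  also have "\<dots> = (real b - 1) * (\<Sum>u\<in>?P. g u)
      - (real b - real \<alpha>) * (\<Sum>u\<in>{u \<in> ?P. y \<rightarrow> u}. g u)"
    unfolding sum_subtractf sum_distrib_left[symmetric]
    by (subst sum.inter_filter) simp_all
  also have "{u \<in> ?P. y \<rightarrow> u} = common_neighbors G x y"
    by (auto simp: common_neighbors_def)
  finally show ?thesis .
qed

text \<open>The maximal drop \<open>L\<close> of \<open>f\<close> along an arc bounds every drop on
  the arcs from \<open>P\<close> to \<open>Q\<close>. The given arc with distinct values ensures
  that \<open>L\<close> is positive and can be cancelled.\<close>

lemma eigenvalue_bound:
  fixes f :: "'a \<Rightarrow> real"
  assumes eig: "\<And>x. x \<in> verts G \<Longrightarrow> (\<Sum>w\<in>neighbors x. f w) = c * f x"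
    and arc: "u\<^sub>0 \<rightarrow> v\<^sub>0" "f u\<^sub>0 \<noteq> f v\<^sub>0" and b: "\<beta> = 0 \<or> b = \<beta>"
  shows "(real b - 1) * (c - real d + 2) + real \<alpha> * (real b - real \<alpha>) \<le> 0"
proof -
  let ?D = "(\<lambda>(u, v). f u - f v) ` arcs_ends G"
  have fin: "finite ?D"
    using finite_arcs by (auto simp: arcs_ends_def)
  have "Max ?D \<in> ?D"
    using fin arc by (intro Max_in) auto
  then obtain x y where xy: "x \<rightarrow> y" and M: "Max ?D = f x - f y"
    by auto
  have le: "f u - f v \<le> f x - f y" if "u \<rightarrow> v" for u v
    using Max_ge[OF fin, of "f u - f v"] that M by force
  define L where "L = f x - f y"
  \<comment> \<open>Reversing an arc flips the sign of the difference, so the maximum is at least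
    the absolute value of \<open>f u\<^sub>0 - f v\<^sub>0\<close>.\<close>
  have "L > 0"
    using le[OF arc(1)] le[of v\<^sub>0 u\<^sub>0] arc adj_sym by (auto simp: L_def)
  have yx: "y \<rightarrow> x" and V: "x \<in> verts G" "y \<in> verts G"
    using xy adj_sym adj_in_verts by auto
  define P Q where "P = neighbors x - {y}" and "Q = neighbors y - {x}"
  have PQ: "finite P" "finite Q"
    by (auto simp: P_def Q_def)
  have cardP: "real (card P) = real d - 1"
  proof -
    have "y \<in> neighbors x" using V xy by simp
    then have "Suc (card P) = card (neighbors x)"
      unfolding P_def by (intro card_Suc_Diff1) auto
    then show ?thesis using card_neighbors[OF V(1)] by simp
  qed
  have cn: "common_neighbors G y x = common_neighbors G x y"
    "card (common_neighbors G x y) = \<alpha>"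
    using adjacent[OF V xy] by (auto simp: common_neighbors_def)
  have sumP: "(\<Sum>u\<in>P. f u) = c * f x - f y" and sumQ: "(\<Sum>u\<in>Q. f u) = c * f y - f x"
    using V xy yx eig by (auto simp: P_def Q_def sum_diff1)
  \<comment> \<open>The contribution of the common neighbors is the same seen from \<open>P\<close>
    and from \<open>Q\<close>, so it cancels in the difference of \<open>PP\<close> and
    \<open>QQ\<close>.\<close>
  define S where "S = (\<Sum>u\<in>common_neighbors G x y. f u)"
  have PP: "(\<Sum>u\<in>P. real (card {v \<in> Q. u \<rightarrow> v}) * f u)
      = (real b - 1) * (\<Sum>u\<in>P. f u) - (real b - real \<alpha>) * S"
    unfolding P_def Q_def S_def by (rule sum_card_neighbors_across[OF b xy])
  have QQ: "(\<Sum>v\<in>Q. real (card {u \<in> P. v \<rightarrow> u}) * f v)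
      = (real b - 1) * (\<Sum>v\<in>Q. f v) - (real b - real \<alpha>) * S"
    unfolding P_def Q_def S_def cn(1)[symmetric] by (rule sum_card_neighbors_across[OF b yx])
  have count: "(\<Sum>u\<in>P. real (card {v \<in> Q. u \<rightarrow> v}))
      = (real b - 1) * (real d - 1) - (real b - real \<alpha>) * real \<alpha>"
    using sum_card_neighbors_across[OF b xy, of "\<lambda>_. 1"] cardP cn(2)
    by (simp add: P_def Q_def)
  \<comment> \<open>The sum weighted by degrees into \<open>P\<close> is regrouped by the endpoint
    in \<open>P\<close>, so that both weighted sums run over the same arcs.\<close>
  have "(\<Sum>v\<in>Q. real (card {u \<in> P. v \<rightarrow> u}) * f v) = (\<Sum>v\<in>Q. \<Sum>u\<in>{u \<in> P. v \<rightarrow> u}. f v)"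
    by simp
  also have "\<dots> = (\<Sum>u\<in>P. \<Sum>v\<in>{v \<in> Q. v \<rightarrow> u}. f v)"
    using PQ by (intro sum.swap_restrict) auto
  also have "\<dots> = (\<Sum>u\<in>P. \<Sum>v\<in>{v \<in> Q. u \<rightarrow> v}. f v)"
    by (intro sum.cong) (use adj_sym in auto)
  finally have swap: "(\<Sum>v\<in>Q. real (card {u \<in> P. v \<rightarrow> u}) * f v)
    = (\<Sum>u\<in>P. \<Sum>v\<in>{v \<in> Q. u \<rightarrow> v}. f v)" .
  have "(real b - 1) * ((c + 1) * L) = (real b - 1) * ((\<Sum>u\<in>P. f u) - (\<Sum>u\<in>Q. f u))"
    by (simp add: sumP sumQ L_def algebra_simps)
  also have "\<dots> = (\<Sum>u\<in>P. \<Sum>v\<in>{v \<in> Q. u \<rightarrow> v}. f u - f v)"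
    using PP QQ swap by (simp add: sum_subtractf right_diff_distrib)
  also have "\<dots> \<le> (\<Sum>u\<in>P. \<Sum>v\<in>{v \<in> Q. u \<rightarrow> v}. L)"
    by (intro sum_mono) (use le in \<open>auto simp: L_def\<close>)
  also have "\<dots> = ((real b - 1) * (real d - 1) - (real b - real \<alpha>) * real \<alpha>) * L"
    by (simp add: count flip: sum_distrib_right)
  finally have "(real b - 1) * (c + 1) * L
      \<le> ((real b - 1) * (real d - 1) - (real b - real \<alpha>) * real \<alpha>) * L"
    by (simp add: mult.assoc)
  then have "(real b - 1) * (c + 1) \<le> (real b - 1) * (real d - 1) - (real b - real \<alpha>) * real \<alpha>"
    using \<open>L > 0\<close> by simp
  then show ?thesis by (simp add: algebra_simps)
qed

text \<open>Both parts divide the general bound by the positive factor \<open>b - 1\<close> or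
  \<open>\<beta> - 1\<close>; they differ in the lower estimate for the term
  \<open>\<alpha> (b - \<alpha>)\<close>.\<close>

lemma eigenvalue_gap:
  fixes f :: "'a \<Rightarrow> real"
  assumes eig: "\<And>x. x \<in> verts G \<Longrightarrow> (\<Sum>w\<in>neighbors x. f w) = c * f x"
    and arc: "u\<^sub>0 \<rightarrow> v\<^sub>0" "f u\<^sub>0 \<noteq> f v\<^sub>0"
  shows "\<beta> \<noteq> 1 \<Longrightarrow> \<beta> \<ge> \<alpha> \<Longrightarrow> c \<le> real d - 2"
    and "\<beta> > \<alpha> \<Longrightarrow> \<alpha> \<ge> 1 \<Longrightarrow> c \<le> real d - 3"
proof -
  assume 1: "\<beta> \<noteq> 1" "\<beta> \<ge> \<alpha>"
  \<comment> \<open>When \<open>\<beta> = 0\<close>, also \<open>\<alpha> = 0\<close>, and the value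
    2 keeps \<open>b - 1\<close> positive and \<open>b\<close> at least
    \<open>\<alpha>\<close>.\<close>
  define b where "b = (if \<beta> = 0 then 2 else \<beta>)"
  have b: "b \<ge> 2" "b \<ge> \<alpha>"
    using 1 by (auto simp: b_def)
  have "(real b - 1) * (c - real d + 2) + real \<alpha> * (real b - real \<alpha>) \<le> 0"
    by (rule eigenvalue_bound[OF eig arc]) (auto simp: b_def)
  moreover have "0 \<le> real \<alpha> * (real b - real \<alpha>)"
    using b by simp
  ultimately have "(real b - 1) * (c - real d + 2) \<le> 0"
    by linarith
  then show "c \<le> real d - 2"
    using b by (auto simp: mult_le_0_iff)
next
  assume 2: "\<beta> > \<alpha>" "\<alpha> \<ge> 1"
  have "(real \<beta> - 1) * (c - real d + 2) + real \<alpha> * (real \<beta> - real \<alpha>) \<le> 0"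
    by (rule eigenvalue_bound[OF eig arc]) auto
  \<comment> \<open>This product equals
    \<open>\<alpha> (\<beta> - \<alpha>) - (\<beta> - 1)\<close>, so the extra term gains one more
    multiple of \<open>\<beta> - 1\<close>.\<close>
  moreover have "0 \<le> (real \<alpha> - 1) * (real \<beta> - real \<alpha> - 1)"
    using 2 by (intro mult_nonneg_nonneg) auto
  ultimately have "(real \<beta> - 1) * (c - real d + 3) \<le> 0"
    by (simp add: algebra_simps)
  then show "c \<le> real d - 3"
    using 2 by (auto simp: mult_le_0_iff)
qed

section \<open>The adjacency matrix as an operator on vertex functions\<close>

context
  fixes vs :: "'a list"
  assumes dist: "distinct vs" and set: "set vs = verts G"
begin

lemma length_vs: "length vs = n"
  using dist set card_verts distinct_card by metis

lemma adjacency_carrier: "adjacency_matrix G vs \<in> carrier_mat n n"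
  by (simp add: adjacency_matrix_def length_vs)

lemma obtain_vertex_function:
  assumes "v \<in> carrier_vec n"
  obtains f where "v = vec n (\<lambda>i. f (vs ! i))"
proof
  show "v = vec n (\<lambda>i. v $ (the_inv_into {..<n} ((!) vs) (vs ! i)))"
    using assms dist
    by (intro eq_vecI) (auto simp: the_inv_into_f_f inj_on_nth length_vs)
qed

lemma vec_eq_iff_on_verts:
  "vec n (\<lambda>i. f (vs ! i)) = vec n (\<lambda>i. g (vs ! i)) \<longleftrightarrow> (\<forall>x\<in>verts G. f x = g x)"
  unfolding set[symmetric] by (auto simp: vec_eq_iff all_set_conv_all_nth length_vs)

lemma adjacency_mult_vec:
  fixes f :: "'a \<Rightarrow> real"
  shows "adjacency_matrix G vs *\<^sub>v vec n (\<lambda>i. f (vs ! i))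
    = vec n (\<lambda>i. \<Sum>w\<in>neighbors (vs ! i). f w)"
proof (intro eq_vecI)
  fix i assume "i < dim_vec (vec n (\<lambda>i. \<Sum>w\<in>neighbors (vs ! i). f w))"
  then have i: "i < n" by simp
  have bij: "bij_betw ((!) vs) {0..<n} (verts G)"
    using bij_betw_nth[OF dist, of "{0..<n}" "verts G"] set length_vs
    by (simp add: atLeast0LessThan)
  have "(adjacency_matrix G vs *\<^sub>v vec n (\<lambda>i. f (vs ! i))) $ i
      = (\<Sum>j = 0..<n. if vs ! i \<rightarrow> vs ! j then f (vs ! j) else 0)"
    using i by (auto simp: adjacency_matrix_def length_vs scalar_prod_def intro!: sum.cong)
  also have "\<dots> = (\<Sum>w\<in>verts G. if vs ! i \<rightarrow> w then f w else 0)"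
    by (rule sum.reindex_bij_betw[OF bij])
  also have "\<dots> = (\<Sum>w\<in>neighbors (vs ! i). f w)"
    by (simp add: sum.inter_filter)
  finally show "(adjacency_matrix G vs *\<^sub>v vec n (\<lambda>i. f (vs ! i))) $ i
      = vec n (\<lambda>i. \<Sum>w\<in>neighbors (vs ! i). f w) $ i"
    using i by simp
qed (simp add: adjacency_matrix_def length_vs)

lemma eigenvalue_adjacency_iff:
  "eigenvalue (adjacency_matrix G vs) c \<longleftrightarrow>
    (\<exists>f. (\<forall>x\<in>verts G. (\<Sum>w\<in>neighbors x. f w) = c * f x) \<and> (\<exists>x\<in>verts G. f x \<noteq> 0))"
proof -
  let ?v = "\<lambda>f. vec n (\<lambda>i. f (vs ! i))"
  have *: "eigenvector (adjacency_matrix G vs) (?v f) c \<longleftrightarrow>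
      (\<forall>x\<in>verts G. (\<Sum>w\<in>neighbors x. f w) = c * f x) \<and> (\<exists>x\<in>verts G. f x \<noteq> 0)" for f
  proof -
    have "c \<cdot>\<^sub>v ?v f = ?v (\<lambda>x. c * f x)" "0\<^sub>v n = ?v (\<lambda>_. 0)"
      by auto
    then have "eigenvector (adjacency_matrix G vs) (?v f) c \<longleftrightarrow>
        ?v f \<noteq> ?v (\<lambda>_. 0) \<and> ?v (\<lambda>x. \<Sum>w\<in>neighbors x. f w) = ?v (\<lambda>x. c * f x)"
      using adjacency_carrier unfolding eigenvector_def adjacency_mult_vec by auto
    then show ?thesis
      unfolding vec_eq_iff_on_verts[of f "\<lambda>_. 0"]
        vec_eq_iff_on_verts[of "\<lambda>x. \<Sum>w\<in>neighbors x. f w" "\<lambda>x. c * f x"] by blast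
  qed
  have "eigenvalue (adjacency_matrix G vs) c \<longleftrightarrow> (\<exists>f. eigenvector (adjacency_matrix G vs) (?v f) c)"
    unfolding eigenvalue_def using adjacency_carrier obtain_vertex_function
    by (metis carrier_matD(1) eigenvector_def)
  then show ?thesis by (simp add: *)
qed

text \<open>A double root would give a chain \<open>v\<close>, \<open>w\<close>. Here
  \<open>v\<close> is a nonzero constant function; summing the equation for \<open>w\<close> over
  all vertices forces \<open>b = 0\<close>, so \<open>w\<close> is constant as well and hence a
  multiple of \<open>v\<close>.\<close>

lemma degree_simple_root:
  assumes con: "connected G"
  shows "char_poly (adjacency_matrix G vs) \<noteq> (\<Prod>a\<leftarrow>real d # real d # es. [:- a, 1:])"
proof
  assume "char_poly (adjacency_matrix G vs) = (\<Prod>a\<leftarrow>real d # real d # es. [:- a, 1:])"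
  then obtain v w b where vw: "v \<in> carrier_vec n" "w \<in> carrier_vec n" "v \<noteq> 0\<^sub>v n"
    "\<And>t. w \<noteq> t \<cdot>\<^sub>v v" "adjacency_matrix G vs *\<^sub>v v = real d \<cdot>\<^sub>v v"
    "adjacency_matrix G vs *\<^sub>v w = real d \<cdot>\<^sub>v w + b \<cdot>\<^sub>v v"
    using double_root_chain[OF adjacency_carrier] by metis
  obtain f where f: "v = vec n (\<lambda>i. f (vs ! i))"
    using obtain_vertex_function[OF vw(1)] .
  obtain g where g: "w = vec n (\<lambda>i. g (vs ! i))"
    using obtain_vertex_function[OF vw(2)] .
  have "real d \<cdot>\<^sub>v v = vec n (\<lambda>i. real d * f (vs ! i))"
    by (auto simp: f)
  then have eigf: "(\<Sum>w\<in>neighbors x. f w) = real d * f x" if "x \<in> verts G" for x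
    using vw(5) that unfolding f adjacency_mult_vec
    by (simp add: vec_eq_iff_on_verts[of "\<lambda>x. \<Sum>w\<in>neighbors x. f w" "\<lambda>x. real d * f x"])
  have "real d \<cdot>\<^sub>v w + b \<cdot>\<^sub>v v = vec n (\<lambda>i. real d * g (vs ! i) + b * f (vs ! i))"
    by (auto simp: f g)
  then have eigg: "(\<Sum>w\<in>neighbors x. g w) = real d * g x + b * f x" if "x \<in> verts G" for x
    using vw(6) that unfolding g adjacency_mult_vec
    by (simp add: vec_eq_iff_on_verts[of "\<lambda>x. \<Sum>w\<in>neighbors x. g w" "\<lambda>x. real d * g x + b * f x"])
  obtain z where z: "z \<in> verts G" "f z \<noteq> 0"
    using vw(3) vec_eq_iff_on_verts[of f "\<lambda>_. 0"] by (auto simp: f zero_vec_def)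
  have fz: "f x = f z" if "x \<in> verts G" for x
    by (rule degree_eigenfunction_constant[OF con _ that z(1)]) (rule eigf)
  \<comment> \<open>Summation over the vertices is pairing with the constant function, an
    eigenfunction for \<open>d\<close>; the terms in \<open>g\<close> cancel and leave
    \<open>b n f z = 0\<close>.\<close>
  have "real d * (\<Sum>x\<in>verts G. g x) = (\<Sum>x\<in>verts G. real d * g x + b * f x)"
    using eigg by (simp flip: sum_sum_neighbors)
  also have "\<dots> = real d * (\<Sum>x\<in>verts G. g x) + b * real n * f z"
    using fz by (simp add: sum.distrib card_verts flip: sum_distrib_left)
  finally have "b * real n = 0"
    using z by simp
  moreover have "n \<noteq> 0"
    using z card_verts by (auto simp: card_gt_0_iff)
  ultimately have "b = 0"
    by simp
  then have gz: "g x = g z" if "x \<in> verts G" for x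
    using degree_eigenfunction_constant[OF con _ that z(1), of g] eigg by simp
  have "g x = g z / f z * f x" if "x \<in> verts G" for x
    using fz[OF that] gz[OF that] z by simp
  then have "vec n (\<lambda>i. g (vs ! i)) = vec n (\<lambda>i. g z / f z * f (vs ! i))"
    unfolding vec_eq_iff_on_verts[of g "\<lambda>x. g z / f z * f x"] by blast
  also have "\<dots> = (g z / f z) \<cdot>\<^sub>v v"
    unfolding f by (intro eq_vecI) auto
  finally have "w = (g z / f z) \<cdot>\<^sub>v v"
    unfolding g .
  then show False
    using vw(4) by blast
qed

end

end

section \<open>The two largest eigenvalues\<close>

theorem corollary1p6:
  fixes G :: "('a, 'b) pre_digraph"
    and n d \<alpha> \<beta> :: nat
    and vs :: "'a list"
    and \<sigma> :: "nat \<Rightarrow> real"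
  assumes "amply_regular_graph G n d \<alpha> \<beta>"
    and "Digraph_Component.connected G"
    and "n \<ge> 2"
    and "distinct vs" and "set vs = verts G"
    and "ordered_eigenvalues (adjacency_matrix G vs) \<sigma>"
  shows "\<sigma> n = real d \<and>
    (\<beta> \<noteq> 1 \<and> \<beta> \<ge> \<alpha> \<longrightarrow> \<sigma> (n - 1) \<le> real d - 2) \<and>
    (\<beta> > \<alpha> \<and> \<alpha> \<ge> 1 \<longrightarrow> \<sigma> (n - 1) \<le> real d - 3)"
proof -
  interpret amply_regular_graph G n d \<alpha> \<beta> by fact
  let ?A = "adjacency_matrix G vs"
  note A = adjacency_carrier[OF assms(4,5)]
  note ev_iff = eigenvalue_adjacency_iff[OF assms(4,5)]
  have mono: "mono_on {1..n} \<sigma>" and char: "char_poly ?A = (\<Prod>i = 1..n. [:- \<sigma> i, 1:])"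
    using assms(6) A by (auto simp: ordered_eigenvalues_def)
  have root: "eigenvalue ?A c \<longleftrightarrow> (\<exists>i\<in>{1..n}. c = \<sigma> i)" for c
    unfolding eigenvalue_root_char_poly[OF A] char by (auto simp: poly_prod)
  have "verts G \<noteq> {}"
    using assms(3) card_verts by auto
  then have "eigenvalue ?A (real d)"
    \<comment> \<open>By regularity the constant function 1 is an eigenfunction for
      \<open>d\<close>.\<close>
    unfolding ev_iff using card_neighbors by (intro exI[of _ "\<lambda>_. 1"]) auto
  then obtain i where "i \<in> {1..n}" "real d = \<sigma> i"
    using root by blast
  then have "real d \<le> \<sigma> n"
    using mono_onD[OF mono, of i n] by auto
  moreover have "eigenvalue ?A (\<sigma> n)"
    using root assms(3) by auto
  then have "\<sigma> n \<le> real d"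
    unfolding ev_iff by (auto intro: eigenvalue_le_degree)
  ultimately have top: "\<sigma> n = real d"
    by simp
  have "\<sigma> (n - 1) \<noteq> real d"
  proof
    assume second: "\<sigma> (n - 1) = real d"
    \<comment> \<open>Writing \<open>n = m + 2\<close> splits off the top two linear factors, which
      would both belong to \<open>d\<close>.\<close>
    obtain m where m: "n = Suc (Suc m)"
      using assms(3) by (metis Suc_le_D numeral_2_eq_2 Suc_le_mono)
    have "(\<Prod>i = 1..m. [:- \<sigma> i, 1:]) = (\<Prod>a\<leftarrow>map \<sigma> [1..<Suc m]. [:- a, 1:])"
      by (simp add: o_def prod.distinct_set_conv_list[symmetric] atLeastLessThanSuc_atLeastAtMost del: upt_Suc)
    then have "char_poly ?A = (\<Prod>a\<leftarrow>real d # real d # map \<sigma> [1..<Suc m]. [:- a, 1:])"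
      using top second unfolding char m by (simp add: mult_ac del: upt_Suc)
    then show False
      using degree_simple_root[OF assms(4,5,2)] by blast
  qed
  have "eigenvalue ?A (\<sigma> (n - 1))"
    using root assms(3) by auto
  then obtain f z where eig: "\<And>x. x \<in> verts G \<Longrightarrow> (\<Sum>w\<in>neighbors x. f w) = \<sigma> (n - 1) * f x"
    and z: "z \<in> verts G" "f z \<noteq> 0"
    unfolding ev_iff by blast
  \<comment> \<open>If \<open>f\<close> were constant on arcs, the eigenvalue equation at
    \<open>z\<close> would read \<open>d f z = \<sigma> (n - 1) f z\<close>, contrary to the
    simplicity of \<open>d\<close>.\<close>
  have "\<exists>u v. u \<rightarrow>\<^bsub>G\<^esub> v \<and> f u \<noteq> f v"
  proof (rule ccontr)
    assume "\<not> (\<exists>u v. u \<rightarrow>\<^bsub>G\<^esub> v \<and> f u \<noteq> f v)"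
    then have "(\<Sum>w\<in>neighbors z. f w) = (\<Sum>w\<in>neighbors z. f z)"
      by (intro sum.cong) auto
    then show False
      using eig[OF z(1)] z card_neighbors[OF z(1)] \<open>\<sigma> (n - 1) \<noteq> real d\<close> by simp
  qed
  then obtain u v where uv: "u \<rightarrow>\<^bsub>G\<^esub> v" "f u \<noteq> f v"
    by blast
  have "\<sigma> (n - 1) \<le> real d - 2" if "\<beta> \<noteq> 1" "\<beta> \<ge> \<alpha>"
    by (rule eigenvalue_gap(1)[OF _ uv that]) (rule eig)
  moreover have "\<sigma> (n - 1) \<le> real d - 3" if "\<beta> > \<alpha>" "\<alpha> \<ge> 1"
    by (rule eigenvalue_gap(2)[OF _ uv that]) (rule eig)
  ultimately show ?thesis
    using top by blast
qed

end
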